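(* The everywhere doubled line $D$ is a connected non-Hausdorff homogeneous separable $1$-manifold.
   Context: The everywhere doubled line $D$ is the following topological space. Its underlying set is $\mathbb{R}\times\{0,1\}$. A base for its topology is given by the subsets of the form $$\mathcal{U}_{O,F}=(O\setminus F)\times\{0\}\,\cup\,F\times\{1\},$$ where $O\subset\mathbb{R}$ is open (in the usual topology) and $F\subset O$ is finite (possibly empty); this collection is closed under finite intersections. A $1$-manifold is a topological space in which every point has an open neighborhood homeomorphic to $\mathbb{R}$ (neither the Hausdorff axiom nor second countability is assumed). A topological space $X$ is homogeneous if for all $x,y\in X$ there is a homeomorphism $h:X\to X$ with $h(x)=y$. A space is separable if it has a countable dense subset. *)

theory Defs
  imports "HOL-Analysis.Analysis"
begin

definition doubled_basic :: "real set \<Rightarrow> real set \<Rightarrow> (real \<times> nat) set" where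
  "doubled_basic O' F = (O' - F) \<times> {0} \<union> F \<times> {1}"

definition doubled_base :: "(real \<times> nat) set \<Rightarrow> bool" where
  "doubled_base U \<longleftrightarrow> (\<exists>O' F. open O' \<and> finite F \<and> F \<subseteq> O' \<and> U = doubled_basic O' F)"

definition everywhere_doubled_line :: "(real \<times> nat) topology" where
  "everywhere_doubled_line = topology (arbitrary union_of doubled_base)"

text \<open>\<^const>\<open>topology\<close> is only meaningful on families of sets that form a topology; the next two
  lemmas discharge this.\<close>

lemma doubled_base_Int:
  assumes "doubled_base U" "doubled_base V"
  shows "doubled_base (U \<inter> V)"
proof -
  obtain A F where U: "open A" "finite F" "F \<subseteq> A" "U = doubled_basic A F"
    using assms(1) by (auto simp: doubled_base_def)
  obtain B G where V: "open B" "finite G" "G \<subseteq> B" "V = doubled_basic B G"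
    using assms(2) by (auto simp: doubled_base_def)
  let ?C = "A \<inter> B - ((F - G) \<union> (G - F))"
  have "open ?C"
    using U V by (intro open_Diff open_Int finite_imp_closed) auto
  moreover have "U \<inter> V = doubled_basic ?C (F \<inter> G)"
    using U V by (auto simp: doubled_basic_def)
  moreover have "finite (F \<inter> G)" "F \<inter> G \<subseteq> ?C"
    using U V by auto
  ultimately show ?thesis
    unfolding doubled_base_def by blast
qed

lemma openin_everywhere_doubled_line:
  "openin everywhere_doubled_line = arbitrary union_of doubled_base"
  unfolding everywhere_doubled_line_def
  by (intro topology_inverse' istopology_base doubled_base_Int)

lemma topspace_everywhere_doubled_line:
  "topspace everywhere_doubled_line = UNIV \<times> {0, 1}"
proof
  show "topspace everywhere_doubled_line \<subseteq> UNIV \<times> {0, 1}"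
    unfolding topspace_def openin_everywhere_doubled_line union_of_def arbitrary_def
    by (fastforce simp: doubled_base_def doubled_basic_def)
  show "UNIV \<times> {0, 1} \<subseteq> topspace everywhere_doubled_line"
  proof
    fix p :: "real \<times> nat" assume p: "p \<in> UNIV \<times> {0, 1}"
    define F where "F = (if snd p = 0 then {} else {fst p})"
    have "doubled_base (doubled_basic UNIV F)"
      unfolding doubled_base_def F_def by (intro exI[of _ UNIV] exI conjI) auto
    then have "openin everywhere_doubled_line (doubled_basic UNIV F)"
      by (simp add: openin_everywhere_doubled_line arbitrary_def union_of_inc)
    moreover have "p \<in> doubled_basic UNIV F"
      using p by (auto simp: doubled_basic_def F_def)
    ultimately show "p \<in> topspace everywhere_doubled_line"
      by (meson openin_subset subsetD)
  qed
qed

text \<open>Neither Hausdorffness nor second countability is required of a 1-manifold.\<close>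

definition one_manifold :: "'a topology \<Rightarrow> bool" where
  "one_manifold X \<longleftrightarrow>
     (\<forall>x \<in> topspace X. \<exists>U. openin X U \<and> x \<in> U \<and>
        subtopology X U homeomorphic_space euclideanreal)"

definition homogeneous_space :: "'a topology \<Rightarrow> bool" where
  "homogeneous_space X \<longleftrightarrow>
     (\<forall>x \<in> topspace X. \<forall>y \<in> topspace X. \<exists>h. homeomorphic_map X X h \<and> h x = y)"

end

theory Submission
  imports Defs
begin

text \<open>For finite \<open>F\<close> the sheet \<open>doubled_basic UNIV F\<close> is open and the first projection maps it
  homeomorphically onto the line; these sheets form a manifold atlas. Open sets of the line are
  infinite, so finite modifications are never visible to density: the sheet \<open>doubled_basic UNIV {}\<close>
  and its rational points are dense, which gives connectedness and separability, while the two points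
  over a real number cannot be separated. Translations combined with exchanging the two points over
  finitely many reals are homeomorphisms, which gives homogeneity.\<close>

lemma mem_doubled_basic [simp]:
  "(t, k) \<in> doubled_basic A F \<longleftrightarrow> t \<in> A - F \<and> k = 0 \<or> t \<in> F \<and> k = 1"
  by (auto simp: doubled_basic_def)

lemma openin_doubled_basic:
  assumes "open A" "finite F" "F \<subseteq> A"
  shows "openin everywhere_doubled_line (doubled_basic A F)"
  unfolding openin_everywhere_doubled_line
  by (intro arbitrary_union_of_inc) (use assms in \<open>auto simp: doubled_base_def\<close>)

lemma openin_doubled_basicE:
  assumes "openin everywhere_doubled_line U" "p \<in> U"
  obtains A F where "open A" "finite F" "F \<subseteq> A" "p \<in> doubled_basic A F" "doubled_basic A F \<subseteq> U"
proof -
  obtain B where "doubled_base B" "p \<in> B" "B \<subseteq> U"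
    using assms unfolding openin_everywhere_doubled_line arbitrary_union_of_alt by meson
  then show thesis
    using that unfolding doubled_base_def by metis
qed

lemma continuous_map_everywhere_doubled_line:
  assumes "\<And>p. p \<in> topspace X \<Longrightarrow> f p \<in> UNIV \<times> {0, 1}"
    and "\<And>A F. \<lbrakk>open A; finite F; F \<subseteq> A\<rbrakk> \<Longrightarrow> openin X {p \<in> topspace X. f p \<in> doubled_basic A F}"
  shows "continuous_map X everywhere_doubled_line f"
  by (rule continuous_map_into_topology_base[OF openin_everywhere_doubled_line])
     (use assms in \<open>auto simp: topspace_everywhere_doubled_line doubled_base_def\<close>)

lemma continuous_map_fst_doubled:
  "continuous_map everywhere_doubled_line euclideanreal fst"
  unfolding continuous_map_openin_preimage_eq
proof (intro conjI allI impI)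
  fix A :: "real set" assume "openin euclideanreal A"
  then have A: "open A" by simp
  \<comment> \<open>Over an infinite \<open>A\<close> no single basic set contains all the upper
    points, since the exchanged set must be finite. So each \<open>t\<close> in \<open>A\<close>
    gets its own basic set, which supplies \<open>(t, 1)\<close>, and
    \<open>doubled_basic A {}\<close> supplies the lower points.\<close>
  have "topspace everywhere_doubled_line \<inter> fst -` A = doubled_basic A {} \<union> (\<Union>t\<in>A. doubled_basic A {t})"
    by (rule set_eqI, case_tac x) (simp add: topspace_everywhere_doubled_line, blast)
  moreover have "openin everywhere_doubled_line (\<Union>t\<in>A. doubled_basic A {t})"
    using A by (intro openin_Union) (auto intro: openin_doubled_basic)
  ultimately show "openin everywhere_doubled_line (topspace everywhere_doubled_line \<inter> fst -` A)"
    using A by (simp add: openin_Un openin_doubled_basic)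
qed auto

text \<open>This section of \<open>fst\<close> has image \<open>doubled_basic UNIV F\<close> and
  serves as the inverse of the chart on that sheet.\<close>

lemma continuous_map_sheet:
  assumes "finite F"
  shows "continuous_map euclideanreal everywhere_doubled_line (\<lambda>t. (t, if t \<in> F then 1 else 0))"
proof (rule continuous_map_everywhere_doubled_line)
  fix A G :: "real set" assume *: "open A" "finite G" "G \<subseteq> A"
  \<comment> \<open>Over \<open>t\<close> in \<open>A\<close>, the section and the basic set choose
    the same point unless \<open>t\<close> lies in exactly one of \<open>F\<close> and
    \<open>G\<close>, so only finitely many reals drop out.\<close>
  have "{t. (t, if t \<in> F then 1 else 0 :: nat) \<in> doubled_basic A G} = A - ((F - G) \<union> (G - F))"
    using * by auto
  moreover have "open (A - ((F - G) \<union> (G - F)))"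
    using * assms by (intro open_Diff finite_imp_closed) auto
  ultimately show "openin euclideanreal
      {t \<in> topspace euclideanreal. (t, if t \<in> F then 1 else 0) \<in> doubled_basic A G}"
    by (simp del: mem_doubled_basic)
qed auto

lemma sheet_homeomorphic_real:
  assumes "finite F"
  shows "subtopology everywhere_doubled_line (doubled_basic UNIV F) homeomorphic_space euclideanreal"
  unfolding homeomorphic_space_def
proof (intro exI)
  show "homeomorphic_maps (subtopology everywhere_doubled_line (doubled_basic UNIV F)) euclideanreal
      fst (\<lambda>t. (t, if t \<in> F then 1 else 0))"
    unfolding homeomorphic_maps_def continuous_map_in_subtopology
    using continuous_map_sheet[OF assms]
    by (auto simp: continuous_map_from_subtopology continuous_map_fst_doubled)
qed

lemma one_manifold_doubled: "one_manifold everywhere_doubled_line"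
  unfolding one_manifold_def
proof
  fix p assume "p \<in> topspace everywhere_doubled_line"
  then have "p \<in> doubled_basic UNIV (if snd p = 0 then {} else {fst p})"
    by (cases p) (auto simp: topspace_everywhere_doubled_line)
  then show "\<exists>U. openin everywhere_doubled_line U \<and> p \<in> U \<and>
      subtopology everywhere_doubled_line U homeomorphic_space euclideanreal"
    by (intro exI[of _ "doubled_basic UNIV (if snd p = 0 then {} else {fst p})"] conjI
        openin_doubled_basic sheet_homeomorphic_real) auto
qed

text \<open>Nonempty open sets of reals are infinite, so \<open>A - F\<close> is still nonempty and
  open, and hence meets the dense set of rationals.\<close>

lemma rational_point_exists:
  fixes A F :: "real set"
  assumes "open A" "finite F" "A \<noteq> {}"
  obtains q where "q \<in> \<rat>" "q \<in> A - F"
proof -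
  have "open (A - F)"
    using assms by (intro open_Diff finite_imp_closed)
  moreover have "A - F \<noteq> {}"
    using assms finite_imp_not_open[of A] finite_subset[of A F] by auto
  moreover have "closure \<rat> = (UNIV :: real set)"
    by (rule Rats_closure_real)
  ultimately show thesis
    using that open_Int_closure_eq_empty[of "A - F" \<rat>] by auto
qed

lemma rational_sheet_dense:
  "everywhere_doubled_line closure_of (\<rat> \<times> {0}) = topspace everywhere_doubled_line"
  unfolding dense_intersects_open
proof (intro allI impI, elim conjE)
  fix U assume "openin everywhere_doubled_line U" "U \<noteq> {}"
  then obtain A F p where *: "open A" "finite F" "F \<subseteq> A"
    "p \<in> doubled_basic A F" "doubled_basic A F \<subseteq> U"
    by (meson openin_doubled_basicE all_not_in_conv)
  then have "A \<noteq> {}"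
    by (cases p) auto
  with * obtain q where "q \<in> \<rat>" "q \<in> A - F"
    using rational_point_exists by blast
  then have "(q, 0) \<in> (\<rat> \<times> {0}) \<inter> U"
    using *(5) by auto
  then show "(\<rat> \<times> {0}) \<inter> U \<noteq> {}"
    by blast
qed

lemma separable_doubled: "separable_space everywhere_doubled_line"
  unfolding separable_space_def
  by (rule exI[of _ "\<rat> \<times> {0}"])
     (auto simp: rational_sheet_dense countable_rat topspace_everywhere_doubled_line)

lemma connected_doubled: "connected_space everywhere_doubled_line"
proof -
  let ?S = "doubled_basic UNIV {}"
  have "connected_space euclideanreal"
    using connectedin_topspace[of euclideanreal] by simp
  then have "connected_space (subtopology everywhere_doubled_line ?S)"
    using homeomorphic_connected_space[OF sheet_homeomorphic_real[of "{}"]] by blast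
  then have "connectedin everywhere_doubled_line ?S"
    unfolding connectedin_def using openin_subset[OF openin_doubled_basic[of UNIV "{}"]] by blast
  then have "connectedin everywhere_doubled_line (everywhere_doubled_line closure_of ?S)"
    by (rule connectedin_closure_of)
  \<comment> \<open>The connected sheet contains the dense rational points, so its closure is the
    whole space.\<close>
  moreover have "everywhere_doubled_line closure_of (\<rat> \<times> {0}) \<subseteq> everywhere_doubled_line closure_of ?S"
    by (intro closure_of_mono) auto
  ultimately show ?thesis
    by (metis rational_sheet_dense closure_of_subset_topspace subset_antisym connectedin_topspace)
qed

lemma not_Hausdorff_doubled: "\<not> Hausdorff_space everywhere_doubled_line"
proof
  assume "Hausdorff_space everywhere_doubled_line"
  moreover have "(0, 0) \<in> topspace everywhere_doubled_line" "(0, 1) \<in> topspace everywhere_doubled_line"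
    by (auto simp: topspace_everywhere_doubled_line)
  ultimately obtain U V where UV: "openin everywhere_doubled_line U" "openin everywhere_doubled_line V"
    "(0, 0) \<in> U" "(0, 1) \<in> V" "disjnt U V"
    unfolding Hausdorff_space_def by (metis Pair_inject zero_neq_one)
  obtain A F where A: "open A" "finite F" "F \<subseteq> A" "(0, 0) \<in> doubled_basic A F" "doubled_basic A F \<subseteq> U"
    using UV(1,3) by (rule openin_doubled_basicE)
  obtain B G where B: "open B" "finite G" "G \<subseteq> B" "(0, 1) \<in> doubled_basic B G" "doubled_basic B G \<subseteq> V"
    using UV(2,4) by (rule openin_doubled_basicE)
  \<comment> \<open>Each of the two basic sets contains all but finitely many of the lower points
    over \<open>A \<inter> B\<close>, so they share one.\<close>
  have "0 \<in> A \<inter> B"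
    using A B by auto
  then have "A \<inter> B \<noteq> {}"
    by blast
  with A(1,2) B(1,2) obtain q where "q \<in> A \<inter> B - (F \<union> G)"
    by (metis rational_point_exists open_Int finite_UnI)
  then have "(q, 0) \<in> doubled_basic A F \<inter> doubled_basic B G"
    by auto
  then show False
    using A(5) B(5) UV(5) unfolding disjnt_def by blast
qed

text \<open>\<open>F\<close> is tested before the shift. On the levels 0 and 1, natural subtraction
  in \<open>1 - snd p\<close> is the exchange.\<close>

definition shift_swap :: "real \<Rightarrow> real set \<Rightarrow> real \<times> nat \<Rightarrow> real \<times> nat" where
  "shift_swap c F p = (fst p + c, if fst p \<in> F then 1 - snd p else snd p)"

lemma continuous_map_shift_swap:
  assumes "finite F"
  shows "continuous_map everywhere_doubled_line everywhere_doubled_line (shift_swap c F)"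
proof (rule continuous_map_everywhere_doubled_line)
  fix A G :: "real set" assume *: "open A" "finite G" "G \<subseteq> A"
  let ?A = "(\<lambda>t. t + c) -` A" and ?G = "(\<lambda>t. t + c) -` G"
  \<comment> \<open>\<open>?H\<close> collects the reals whose upper point lands in the target: off
    \<open>F\<close> it stays upper and must arrive over \<open>G\<close>; on \<open>F\<close> it
    becomes lower and must arrive over \<open>A - G\<close>.\<close>
  let ?H = "(?G - F) \<union> (F \<inter> ?A - ?G)"
  have "{p \<in> topspace everywhere_doubled_line. shift_swap c F p \<in> doubled_basic A G}
      = doubled_basic ?A ?H"
    using *(3) by (auto simp: topspace_everywhere_doubled_line shift_swap_def split: if_splits)
  moreover have "open ?A"
    using *(1) by (intro open_vimage continuous_intros)
  moreover have "finite ?G"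
    using *(2) by (intro finite_vimageI) (auto simp: inj_on_def)
  ultimately show "openin everywhere_doubled_line
      {p \<in> topspace everywhere_doubled_line. shift_swap c F p \<in> doubled_basic A G}"
    using * assms by (auto intro!: openin_doubled_basic)
qed (auto simp: shift_swap_def topspace_everywhere_doubled_line)

lemma homeomorphic_map_shift_swap:
  assumes "finite F"
  shows "homeomorphic_map everywhere_doubled_line everywhere_doubled_line (shift_swap c F)"
proof -
  \<comment> \<open>The inverse meets points already shifted by \<open>c\<close>, so it must
    exchange over the translate of \<open>F\<close>.\<close>
  have "homeomorphic_maps everywhere_doubled_line everywhere_doubled_line
      (shift_swap c F) (shift_swap (- c) ((\<lambda>t. t + c) ` F))"
    unfolding homeomorphic_maps_def
    using assms by (auto simp: continuous_map_shift_swap shift_swap_def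
        topspace_everywhere_doubled_line image_iff)
  then show ?thesis
    by (rule homeomorphic_maps_imp_map)
qed

lemma homogeneous_doubled: "homogeneous_space everywhere_doubled_line"
  unfolding homogeneous_space_def
proof (intro ballI)
  fix x y assume "x \<in> topspace everywhere_doubled_line" "y \<in> topspace everywhere_doubled_line"
  \<comment> \<open>The translation matches the real coordinates; an exchange over
    \<open>fst x\<close> is needed only when the levels differ.\<close>
  then have "shift_swap (fst y - fst x) (if snd x = snd y then {} else {fst x}) x = y"
    by (cases x; cases y) (auto simp: shift_swap_def topspace_everywhere_doubled_line)
  moreover have "finite (if snd x = snd y then {} else {fst x})"
    by simp
  ultimately show "\<exists>h. homeomorphic_map everywhere_doubled_line everywhere_doubled_line h \<and> h x = y"
    using homeomorphic_map_shift_swap by blast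
qed

theorem proposition3p1:
  shows "connected_space everywhere_doubled_line \<and>
         \<not> Hausdorff_space everywhere_doubled_line \<and>
         homogeneous_space everywhere_doubled_line \<and>
         separable_space everywhere_doubled_line \<and>
         one_manifold everywhere_doubled_line"
  by (intro conjI connected_doubled not_Hausdorff_doubled homogeneous_doubled separable_doubled
      one_manifold_doubled)

end
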